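(* Let $\mathcal{C}$ be a finitely complete category with a factorization system $(\mathcal{E},\mathcal{M})$, and let $X\in\mathcal{C}$ be a space which has a power object. Two spaces $p:P\to X$ and $q:Q\to X$ over $X$ have isomorphic discrete reflections $\downarrow p\,\cong\,\downarrow q$ (in $\mathcal{M}/X$) if and only if for every map $f:X\to Y$ in $\mathcal{C}$ $$\mathrm{Colim}(f\circ p)\cong \mathrm{Colim}(f\circ q),$$ either side existing if the other one does. In particular: (1) a map $e:P\to X$ is final if and only if for every map $f:X\to Y$ one has $\mathrm{Colim}(f\circ e)\cong\mathrm{Colim}\,f$, either side existing if the other does; (2) a point $x:1\to X$ is the absolute colimit of $p:P\to X$ if and only if for every map $f:X\to Y$ one has $\mathrm{Colim}(f\circ p)\cong f x$.
   Context: Factorization systems. $\mathcal{C}$ has finite limits, with terminal object $1$. Write $e\perp m$ if for every commutative square $ge=mf$ there is a unique $u$ with $ue=f$ and $mu=g$. A factorization system $(\mathcal{E},\mathcal{M})$ consists of classes of arrows with $\mathcal{E}=\{e : e\perp m \text{ for all } m\in\mathcal{M}\}$, $\mathcal{M}=\{m : e\perp m\text{ for all } e\in\mathcal{E}\}$, such that every arrow factors as $m\circ e$ with $e\in\mathcal{E}$, $m\in\mathcal{M}$. Objects of $\mathcal{C}$ are called spaces, arrows are called maps; an object of the slice $\mathcal{C}/X$ is a space over $X$. A map is final if it is in $\mathcal{E}$. A point of $X$ is a map $1\to X$. Reflections. $\mathcal{M}/X$ is the full subcategory of $\mathcal{C}/X$ on the arrows in $\mathcal{M}$ (discrete spaces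 over $X$). It is reflective; a reflection $\downarrow:\mathcal{C}/X\to\mathcal{M}/X$ is fixed: if $p=m\circ e$ with $e\in\mathcal{E}$, $m\in\mathcal{M}$ is the chosen factorization, then $\downarrow p=m$ with reflection map $e:p\to m$. For $f:X\to Y$, $\Delta_f:\mathcal{M}/Y\to\mathcal{M}/X$ is pullback along $f$, with left adjoint $\exists_f:\mathcal{M}/X\to\mathcal{M}/Y$, $\exists_f m=\downarrow(f\circ m)$. Neighborhoods and colimits. The neighborhood of a point $x$ of $X$ is $\nu(x)=\downarrow x\in\mathcal{M}/X$. The adherence category $\overline{X}$ is the full subcategory of $\mathcal{M}/X$ on the neighborhoods of the points of $X$; the object $\nu(x)$ of $\overline X$ is also denoted $x$. For $p\in\mathcal{C}/X$, a cone from $p$ to $x$ is a map $p\to\nu(x)$ over $X$; it is colimiting if it is a reflection of $p$ in the full subcategory $\overline X$ of $\mathcal{C}/X$, and then $x\in\overline X$ is the colimit of $p$, written $\mathrm{Colim}\,p$. Thus $\mathrm{Colim}:\mathcal{C}/X\to\overline X$ is the partially defined left adjoint of the inclusion $\overline X\hookrightarrow\mathcal{C}/X$, and $\mathrm{colim}:\mathcal{M}/X\to\overline X$ is the partially defined left adjoint of the inclusion $j:\overline X\hookrightarrow\mathcal{M}/X$. Isomorphisms of colimits of maps into $Y$ are isomorphisms in $\overline Y$. The point $x$ is an absolute colimit of $p$ if $\downarrow p\cong\nu(x)$ in $\mathcal{M}/X$. Power objects. A map $\mathbf{y}:X\to\mathcal{P}X$ is a Yoneda map if the adjoint composites $\mathrm{colim}\circ\exists_{\mathbf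 y}:\mathcal{M}/X\to\mathcal{M}/\mathcal{P}X\to\overline{\mathcal{P}X}$ and $\Delta_{\mathbf y}\circ j:\overline{\mathcal{P}X}\to\mathcal{M}/\mathcal{P}X\to\mathcal{M}/X$ (are everywhere defined and) constitute an equivalence of categories $\mathcal{M}/X\simeq\overline{\mathcal{P}X}$. Then $\mathcal{P}X$ is called a power object for $X$; "$X$ has a power object" means that such a Yoneda map exists. *)

theory Defs
  imports Main
begin

section \<open>Categories, functors, equivalences\<close>

text \<open>\<open>g \<cdot> f\<close> is the composite ``\<open>g\<close> after \<open>f\<close>''. Operations are total functions; only their values on
  the carriers \<open>Ob\<close> and \<open>Ar\<close> (and, for composition, on composable pairs) are meaningful.\<close>

record ('o, 'a) cat =
  Ob :: "'o set"
  Ar :: "'a set"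
  Dom :: "'a \<Rightarrow> 'o"
  Cod :: "'a \<Rightarrow> 'o"
  Idt :: "'o \<Rightarrow> 'a"
  Cmp :: "'a \<Rightarrow> 'a \<Rightarrow> 'a"  (infixr "\<cdot>\<index>" 70)

definition Hom :: "('o, 'a, 'r) cat_scheme \<Rightarrow> 'o \<Rightarrow> 'o \<Rightarrow> 'a set" where
  "Hom C a b = {f \<in> Ar C. Dom C f = a \<and> Cod C f = b}"

locale category =
  fixes C :: "('o, 'a, 'r) cat_scheme" (structure)
  assumes Dom_in_Ob: "f \<in> Ar C \<Longrightarrow> Dom C f \<in> Ob C"
    and Cod_in_Ob: "f \<in> Ar C \<Longrightarrow> Cod C f \<in> Ob C"
    and Idt_in_Hom: "a \<in> Ob C \<Longrightarrow> Idt C a \<in> Hom C a a"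
    and Cmp_in_Hom: "f \<in> Hom C a b \<Longrightarrow> g \<in> Hom C b c \<Longrightarrow> g \<cdot> f \<in> Hom C a c"
    and Cmp_Idt: "f \<in> Hom C a b \<Longrightarrow> f \<cdot> Idt C a = f"
    and Idt_Cmp: "f \<in> Hom C a b \<Longrightarrow> Idt C b \<cdot> f = f"
    and Cmp_assoc: "f \<in> Hom C a b \<Longrightarrow> g \<in> Hom C b c \<Longrightarrow> h \<in> Hom C c d \<Longrightarrow>
      h \<cdot> (g \<cdot> f) = (h \<cdot> g) \<cdot> f"

definition iso_arrow :: "('o, 'a, 'r) cat_scheme \<Rightarrow> 'o \<Rightarrow> 'o \<Rightarrow> 'a \<Rightarrow> bool" where
  "iso_arrow C a b f \<longleftrightarrow>
    f \<in> Hom C a b \<and> (\<exists>g \<in> Hom C b a. g \<cdot>\<^bsub>C\<^esub> f = Idt C a \<and> f \<cdot>\<^bsub>C\<^esub> g = Idt C b)"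

definition isomorphic :: "('o, 'a, 'r) cat_scheme \<Rightarrow> 'o \<Rightarrow> 'o \<Rightarrow> bool" where
  "isomorphic C a b \<longleftrightarrow> a \<in> Ob C \<and> b \<in> Ob C \<and> (\<exists>f. iso_arrow C a b f)"

definition full_subcat :: "('o, 'a, 'r) cat_scheme \<Rightarrow> 'o set \<Rightarrow> ('o, 'a) cat" where
  "full_subcat C S =
    \<lparr>Ob = Ob C \<inter> S, Ar = {f \<in> Ar C. Dom C f \<in> S \<and> Cod C f \<in> S},
     Dom = Dom C, Cod = Cod C, Idt = Idt C, Cmp = Cmp C\<rparr>"

text \<open>An arrow of the slice from \<open>p\<close> to \<open>q\<close> is a triple \<open>(p, u, q)\<close> with \<open>q \<cdot> u = p\<close>; the outer components
  record its domain and codomain.\<close>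

definition slice :: "('o, 'a, 'r) cat_scheme \<Rightarrow> 'o \<Rightarrow> ('a, 'a \<times> 'a \<times> 'a) cat" where
  "slice C X =
    \<lparr>Ob = {p \<in> Ar C. Cod C p = X},
     Ar = {(p, u, q) | p u q. p \<in> Ar C \<and> Cod C p = X \<and> q \<in> Ar C \<and> Cod C q = X \<and>
             u \<in> Hom C (Dom C p) (Dom C q) \<and> q \<cdot>\<^bsub>C\<^esub> u = p},
     Dom = (\<lambda>(p, u, q). p), Cod = (\<lambda>(p, u, q). q),
     Idt = (\<lambda>p. (p, Idt C (Dom C p), p)),
     Cmp = (\<lambda>(q', v, r) (p, u, q). (p, v \<cdot>\<^bsub>C\<^esub> u, r))\<rparr>"

record ('o, 'a, 'p, 'b) func =
  omap :: "'o \<Rightarrow> 'p"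
  amap :: "'a \<Rightarrow> 'b"

definition is_functor ::
    "('o, 'a, 'r) cat_scheme \<Rightarrow> ('p, 'b, 's) cat_scheme \<Rightarrow> ('o, 'a, 'p, 'b) func \<Rightarrow> bool" where
  "is_functor A B F \<longleftrightarrow>
    (\<forall>a \<in> Ob A. omap F a \<in> Ob B) \<and>
    (\<forall>f \<in> Ar A. amap F f \<in> Hom B (omap F (Dom A f)) (omap F (Cod A f))) \<and>
    (\<forall>a \<in> Ob A. amap F (Idt A a) = Idt B (omap F a)) \<and>
    (\<forall>f \<in> Ar A. \<forall>g \<in> Ar A. Dom A g = Cod A f \<longrightarrow>
      amap F (g \<cdot>\<^bsub>A\<^esub> f) = amap F g \<cdot>\<^bsub>B\<^esub> amap F f)"

text \<open>Also serves as the inclusion functor of any subcategory.\<close>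

definition id_func :: "('o, 'a, 'o, 'a) func" where
  "id_func = \<lparr>omap = (\<lambda>a. a), amap = (\<lambda>f. f)\<rparr>"

definition comp_func ::
    "('p, 'b, 'q, 'c) func \<Rightarrow> ('o, 'a, 'p, 'b) func \<Rightarrow> ('o, 'a, 'q, 'c) func"
    (infixr "\<circ>\<^sub>F" 70) where
  "G \<circ>\<^sub>F F = \<lparr>omap = (\<lambda>a. omap G (omap F a)), amap = (\<lambda>f. amap G (amap F f))\<rparr>"

definition natural_iso ::
    "('o, 'a, 'r) cat_scheme \<Rightarrow> ('p, 'b, 's) cat_scheme \<Rightarrow>
     ('o, 'a, 'p, 'b) func \<Rightarrow> ('o, 'a, 'p, 'b) func \<Rightarrow> ('o \<Rightarrow> 'b) \<Rightarrow> bool" where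
  "natural_iso A B F G t \<longleftrightarrow>
    (\<forall>a \<in> Ob A. iso_arrow B (omap F a) (omap G a) (t a)) \<and>
    (\<forall>f \<in> Ar A. t (Cod A f) \<cdot>\<^bsub>B\<^esub> amap F f = amap G f \<cdot>\<^bsub>B\<^esub> t (Dom A f))"

definition equivalence ::
    "('o, 'a, 'r) cat_scheme \<Rightarrow> ('p, 'b, 's) cat_scheme \<Rightarrow>
     ('o, 'a, 'p, 'b) func \<Rightarrow> ('p, 'b, 'o, 'a) func \<Rightarrow> bool" where
  "equivalence A B F G \<longleftrightarrow>
    is_functor A B F \<and> is_functor B A G \<and>
    (\<exists>h. natural_iso A A id_func (G \<circ>\<^sub>F F) h) \<and>
    (\<exists>e. natural_iso B B (F \<circ>\<^sub>F G) id_func e)"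

text \<open>\<open>is_reflection D B a r t\<close>: the arrow \<open>t: a \<rightarrow> r\<close> of \<open>D\<close> is a reflection of the object \<open>a\<close> in the
  full subcategory \<open>B\<close> of \<open>D\<close>.\<close>

definition is_reflection ::
    "('o, 'a, 'r) cat_scheme \<Rightarrow> ('o, 'a, 's) cat_scheme \<Rightarrow> 'o \<Rightarrow> 'o \<Rightarrow> 'a \<Rightarrow> bool" where
  "is_reflection D B a r t \<longleftrightarrow>
    a \<in> Ob D \<and> r \<in> Ob B \<and> t \<in> Hom D a r \<and>
    (\<forall>b \<in> Ob B. \<forall>g \<in> Hom D a b. \<exists>!h. h \<in> Hom B r b \<and> h \<cdot>\<^bsub>D\<^esub> t = g)"

text \<open>The (possibly partial) left adjoint of the inclusion of \<open>B\<close> in \<open>D\<close> determined by a choice of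
  reflections \<open>t a: a \<rightarrow> R a\<close>; it is meaningful where \<open>t a\<close> is a reflection.\<close>

definition reflector ::
    "('o, 'a, 'r) cat_scheme \<Rightarrow> ('o, 'a, 's) cat_scheme \<Rightarrow> ('o \<Rightarrow> 'o) \<Rightarrow> ('o \<Rightarrow> 'a) \<Rightarrow>
     ('o, 'a, 'o, 'a) func" where
  "reflector D B R t =
    \<lparr>omap = R,
     amap = (\<lambda>u. THE h. h \<in> Hom B (R (Dom D u)) (R (Cod D u)) \<and>
                         h \<cdot>\<^bsub>D\<^esub> t (Dom D u) = t (Cod D u) \<cdot>\<^bsub>D\<^esub> u)\<rparr>"


section \<open>Finite limits\<close>

definition terminal :: "('o, 'a, 'r) cat_scheme \<Rightarrow> 'o \<Rightarrow> bool" where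
  "terminal C t \<longleftrightarrow> t \<in> Ob C \<and> (\<forall>a \<in> Ob C. \<exists>!f. f \<in> Hom C a t)"

definition is_cone ::
    "('j, 'k, 's) cat_scheme \<Rightarrow> ('o, 'a, 'r) cat_scheme \<Rightarrow> ('j, 'k, 'o, 'a) func \<Rightarrow>
     'o \<Rightarrow> ('j \<Rightarrow> 'a) \<Rightarrow> bool" where
  "is_cone J C D v l \<longleftrightarrow>
    v \<in> Ob C \<and> (\<forall>i \<in> Ob J. l i \<in> Hom C v (omap D i)) \<and>
    (\<forall>k \<in> Ar J. amap D k \<cdot>\<^bsub>C\<^esub> l (Dom J k) = l (Cod J k))"

definition is_limit ::
    "('j, 'k, 's) cat_scheme \<Rightarrow> ('o, 'a, 'r) cat_scheme \<Rightarrow> ('j, 'k, 'o, 'a) func \<Rightarrow>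
     'o \<Rightarrow> ('j \<Rightarrow> 'a) \<Rightarrow> bool" where
  "is_limit J C D v l \<longleftrightarrow>
    is_cone J C D v l \<and>
    (\<forall>w m. is_cone J C D w m \<longrightarrow>
      (\<exists>!h. h \<in> Hom C w v \<and> (\<forall>i \<in> Ob J. l i \<cdot>\<^bsub>C\<^esub> h = m i)))"

text \<open>Index categories with carriers in \<open>nat\<close> suffice, since every finite category is isomorphic to
  one of these.\<close>

definition finitely_complete :: "('o, 'a, 'r) cat_scheme \<Rightarrow> bool" where
  "finitely_complete C \<longleftrightarrow>
    (\<forall>(J :: (nat, nat) cat) D.
      category J \<and> finite (Ob J) \<and> finite (Ar J) \<and> is_functor J C D \<longrightarrow>
      (\<exists>v l. is_limit J C D v l))"

definition is_pullback ::
    "('o, 'a, 'r) cat_scheme \<Rightarrow> 'a \<Rightarrow> 'a \<Rightarrow> 'a \<Rightarrow> 'a \<Rightarrow> bool" where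
  "is_pullback C f m a b \<longleftrightarrow>
    a \<in> Ar C \<and> Cod C a = Dom C f \<and> b \<in> Hom C (Dom C a) (Dom C m) \<and>
    f \<cdot>\<^bsub>C\<^esub> a = m \<cdot>\<^bsub>C\<^esub> b \<and>
    (\<forall>T \<in> Ob C. \<forall>a' \<in> Hom C T (Dom C f). \<forall>b' \<in> Hom C T (Dom C m).
      f \<cdot>\<^bsub>C\<^esub> a' = m \<cdot>\<^bsub>C\<^esub> b' \<longrightarrow>
      (\<exists>!w. w \<in> Hom C T (Dom C a) \<and> a \<cdot>\<^bsub>C\<^esub> w = a' \<and> b \<cdot>\<^bsub>C\<^esub> w = b'))"


section \<open>Categories of spaces\<close>

definition orthogonal :: "('o, 'a, 'r) cat_scheme \<Rightarrow> 'a \<Rightarrow> 'a \<Rightarrow> bool" where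
  "orthogonal C e m \<longleftrightarrow>
    (\<forall>f \<in> Hom C (Dom C e) (Dom C m). \<forall>g \<in> Hom C (Cod C e) (Cod C m).
      g \<cdot>\<^bsub>C\<^esub> e = m \<cdot>\<^bsub>C\<^esub> f \<longrightarrow>
      (\<exists>!u. u \<in> Hom C (Cod C e) (Dom C m) \<and> u \<cdot>\<^bsub>C\<^esub> e = f \<and> m \<cdot>\<^bsub>C\<^esub> u = g))"

definition is_factorization ::
    "('o, 'a, 'r) cat_scheme \<Rightarrow> 'a set \<Rightarrow> 'a set \<Rightarrow> 'a \<Rightarrow> 'a \<Rightarrow> 'a \<Rightarrow> bool" where
  "is_factorization C \<E> \<M> p m e \<longleftrightarrow>
    e \<in> \<E> \<and> m \<in> \<M> \<and> Cod C e = Dom C m \<and> p = m \<cdot>\<^bsub>C\<^esub> e"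

definition factorization_system ::
    "('o, 'a, 'r) cat_scheme \<Rightarrow> 'a set \<Rightarrow> 'a set \<Rightarrow> bool" where
  "factorization_system C \<E> \<M> \<longleftrightarrow>
    \<E> = {e \<in> Ar C. \<forall>m \<in> \<M>. orthogonal C e m} \<and>
    \<M> = {m \<in> Ar C. \<forall>e \<in> \<E>. orthogonal C e m} \<and>
    (\<forall>p \<in> Ar C. \<exists>m e. is_factorization C \<E> \<M> p m e)"

text \<open>\<open>fin\<close> is the class \<open>\<E>\<close> of final maps and \<open>dsc\<close> the class \<open>\<M>\<close>; the chosen factorization of \<open>p\<close> is
  \<open>\<down> p \<cdot> rmap p\<close>.\<close>

record ('o, 'a) spaces = "('o, 'a) cat" +
  One :: 'o  ("\<one>\<index>")
  fin :: "'a set"  ("\<E>\<index>")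
  dsc :: "'a set"  ("\<M>\<index>")
  down :: "'a \<Rightarrow> 'a"  ("\<down>\<index> _" [81] 80)
  rmap :: "'a \<Rightarrow> 'a"

locale category_of_spaces = category C
  for C :: "('o, 'a, 'r) spaces_scheme" (structure) +
  assumes finitely_complete: "finitely_complete C"
    and terminal_One: "terminal C \<one>"
    and factorization_system: "factorization_system C \<E> \<M>"
    and chosen_factorization: "p \<in> Ar C \<Longrightarrow> is_factorization C \<E> \<M> p (\<down> p) (rmap C p)"

text \<open>The category \<open>\<M>/X\<close> of discrete spaces over \<open>X\<close>.\<close>

definition discrete :: "('o, 'a, 'r) spaces_scheme \<Rightarrow> 'o \<Rightarrow> ('a, 'a \<times> 'a \<times> 'a) cat" where
  "discrete C X = full_subcat (slice C X) \<M>\<^bsub>C\<^esub>"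

definition points :: "('o, 'a, 'r) spaces_scheme \<Rightarrow> 'o \<Rightarrow> 'a set" where
  "points C X = Hom C \<one>\<^bsub>C\<^esub> X"

definition nbhd :: "('o, 'a, 'r) spaces_scheme \<Rightarrow> 'a \<Rightarrow> 'a" where
  "nbhd C x = \<down>\<^bsub>C\<^esub> x"

definition adherence :: "('o, 'a, 'r) spaces_scheme \<Rightarrow> 'o \<Rightarrow> ('a, 'a \<times> 'a \<times> 'a) cat" where
  "adherence C X = full_subcat (discrete C X) (nbhd C ` points C X)"

text \<open>Colimits of spaces over \<open>X\<close> are objects of the adherence category, i.e. neighborhoods of points.\<close>

definition is_Colim :: "('o, 'a, 'r) spaces_scheme \<Rightarrow> 'o \<Rightarrow> 'a \<Rightarrow> 'a \<Rightarrow> bool" where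
  "is_Colim C X p z \<longleftrightarrow> (\<exists>c. is_reflection (slice C X) (adherence C X) p z c)"

text \<open>\<open>Colim p \<cong> Colim q\<close> for spaces over \<open>X\<close>, either side existing if the other one does.\<close>

definition Colim_iso :: "('o, 'a, 'r) spaces_scheme \<Rightarrow> 'o \<Rightarrow> 'a \<Rightarrow> 'a \<Rightarrow> bool" where
  "Colim_iso C X p q \<longleftrightarrow>
    ((\<exists>z. is_Colim C X p z) \<longleftrightarrow> (\<exists>w. is_Colim C X q w)) \<and>
    (\<forall>z w. is_Colim C X p z \<and> is_Colim C X q w \<longrightarrow> isomorphic (adherence C X) z w)"

definition Colim_iso_point :: "('o, 'a, 'r) spaces_scheme \<Rightarrow> 'o \<Rightarrow> 'a \<Rightarrow> 'a \<Rightarrow> bool" where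
  "Colim_iso_point C X p x \<longleftrightarrow>
    (\<exists>z. is_Colim C X p z \<and> isomorphic (adherence C X) z (nbhd C x))"

definition absolute_colimit :: "('o, 'a, 'r) spaces_scheme \<Rightarrow> 'o \<Rightarrow> 'a \<Rightarrow> 'a \<Rightarrow> bool" where
  "absolute_colimit C X p x \<longleftrightarrow>
    x \<in> points C X \<and> isomorphic (discrete C X) (\<down>\<^bsub>C\<^esub> p) (nbhd C x)"


section \<open>Power objects\<close>

definition down_func ::
    "('o, 'a, 'r) spaces_scheme \<Rightarrow> 'o \<Rightarrow> ('a, 'a \<times> 'a \<times> 'a, 'a, 'a \<times> 'a \<times> 'a) func" where
  "down_func C X =
    reflector (slice C X) (discrete C X) (\<lambda>p. \<down>\<^bsub>C\<^esub> p) (\<lambda>p. (p, rmap C p, \<down>\<^bsub>C\<^esub> p))"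

definition postcomp_func ::
    "('o, 'a, 'r) cat_scheme \<Rightarrow> 'a \<Rightarrow> ('a, 'a \<times> 'a \<times> 'a, 'a, 'a \<times> 'a \<times> 'a) func" where
  "postcomp_func C f =
    \<lparr>omap = (\<lambda>p. f \<cdot>\<^bsub>C\<^esub> p), amap = (\<lambda>(p, u, q). (f \<cdot>\<^bsub>C\<^esub> p, u, f \<cdot>\<^bsub>C\<^esub> q))\<rparr>"

definition Exists_func ::
    "('o, 'a, 'r) spaces_scheme \<Rightarrow> 'a \<Rightarrow> ('a, 'a \<times> 'a \<times> 'a, 'a, 'a \<times> 'a \<times> 'a) func" where
  "Exists_func C f = down_func C (Cod C f) \<circ>\<^sub>F postcomp_func C f"

definition chosen_pullback :: "('o, 'a, 'r) cat_scheme \<Rightarrow> 'a \<Rightarrow> 'a \<Rightarrow> 'a \<times> 'a" where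
  "chosen_pullback C f m = (SOME ab. is_pullback C f m (fst ab) (snd ab))"

definition Delta_func ::
    "('o, 'a, 'r) cat_scheme \<Rightarrow> 'a \<Rightarrow> ('a, 'a \<times> 'a \<times> 'a, 'a, 'a \<times> 'a \<times> 'a) func" where
  "Delta_func C f =
    (let D = (\<lambda>m. fst (chosen_pullback C f m)); pr = (\<lambda>m. snd (chosen_pullback C f m)) in
     \<lparr>omap = D,
      amap = (\<lambda>(m, u, n).
        (D m,
         THE w. w \<in> Hom C (Dom C (D m)) (Dom C (D n)) \<and>
                D n \<cdot>\<^bsub>C\<^esub> w = D m \<and> pr n \<cdot>\<^bsub>C\<^esub> w = u \<cdot>\<^bsub>C\<^esub> pr m,
         D n))\<rparr>)"

text \<open>The colimit functor on discrete spaces over \<open>X\<close>, the partially defined left adjoint of the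
  inclusion of the adherence category in \<open>\<M>/X\<close>, for an arbitrary choice of colimits.\<close>

definition has_colim :: "('o, 'a, 'r) spaces_scheme \<Rightarrow> 'o \<Rightarrow> 'a \<Rightarrow> bool" where
  "has_colim C X m \<longleftrightarrow> (\<exists>z c. is_reflection (discrete C X) (adherence C X) m z c)"

definition chosen_colim ::
    "('o, 'a, 'r) spaces_scheme \<Rightarrow> 'o \<Rightarrow> 'a \<Rightarrow> 'a \<times> ('a \<times> 'a \<times> 'a)" where
  "chosen_colim C X m =
    (SOME zc. is_reflection (discrete C X) (adherence C X) m (fst zc) (snd zc))"

definition colim_func ::
    "('o, 'a, 'r) spaces_scheme \<Rightarrow> 'o \<Rightarrow> ('a, 'a \<times> 'a \<times> 'a, 'a, 'a \<times> 'a \<times> 'a) func" where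
  "colim_func C X =
    reflector (discrete C X) (adherence C X)
      (\<lambda>m. fst (chosen_colim C X m)) (\<lambda>m. snd (chosen_colim C X m))"

definition yoneda_map :: "('o, 'a, 'r) spaces_scheme \<Rightarrow> 'o \<Rightarrow> 'o \<Rightarrow> 'a \<Rightarrow> bool" where
  "yoneda_map C X PX y \<longleftrightarrow>
    y \<in> Hom C X PX \<and>
    (\<forall>m \<in> Ob (discrete C X). has_colim C PX (omap (Exists_func C y) m)) \<and>
    equivalence (discrete C X) (adherence C PX)
      (colim_func C PX \<circ>\<^sub>F Exists_func C y) (Delta_func C y \<circ>\<^sub>F id_func)"

definition has_power_object :: "('o, 'a, 'r) spaces_scheme \<Rightarrow> 'o \<Rightarrow> bool" where
  "has_power_object C X \<longleftrightarrow> (\<exists>PX \<in> Ob C. \<exists>y. yoneda_map C X PX y)"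

end

theory Submission
  imports Defs
begin

text \<open>A cone from \<open>f \<cdot> p\<close> to a point of \<open>Y\<close> is a map over \<open>Y\<close> into a discrete space. If \<open>k: p \<rightarrow> q\<close> is
  a map over \<open>X\<close> whose underlying arrow is final, then \<open>k\<close> is also a map \<open>f \<cdot> p \<rightarrow> f \<cdot> q\<close> over \<open>Y\<close>, and
  its orthogonality to \<open>\<M>\<close> says precisely that composing with it is a bijection between the maps into
  any discrete space over \<open>Y\<close>. Hence \<open>f \<cdot> p\<close> and \<open>f \<cdot> q\<close> have the same colimits
  (\<open>fin_same_Colim\<close>). The reflection map \<open>p \<rightarrow> \<down> p\<close> is final, and so is any isomorphism
  \<open>\<down> p \<rightarrow> \<down> q\<close>; therefore the colimits of \<open>f \<cdot> p\<close> depend only on the isomorphism class of \<open>\<down> p\<close>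
  (\<open>isomorphic_down_Colim_iso\<close>).

  Conversely, a single map suffices to recover \<open>\<down> p\<close>: for a Yoneda map \<open>y: X \<rightarrow> PX\<close>, the equivalence
  \<open>colim \<circ> \<exists>\<^sub>y\<close> sends \<open>\<down> p\<close> to \<open>colim (\<down> (y \<cdot> \<down> p))\<close>, which by the above is \<open>Colim (y \<cdot> p)\<close>
  (\<open>yoneda_Colim\<close>). In particular \<open>Colim (y \<cdot> p)\<close> always exists, and since an equivalence reflects
  isomorphism of objects, \<open>Colim (y \<cdot> p) \<cong> Colim (y \<cdot> q)\<close> forces \<open>\<down> p \<cong> \<down> q\<close>
  (\<open>yoneda_Colim_iso_isomorphic_down\<close>).

  The two special cases take for \<open>q\<close> the identity of \<open>X\<close> and a point of \<open>X\<close>. A map into \<open>X\<close> is final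
  if and only if its discrete reflection is isomorphic to that of the identity
  (\<open>fin_iff_isomorphic_down_Idt\<close>), and a point, as a space over \<open>X\<close>, is its own colimit
  (\<open>is_Colim_point\<close>).\<close>


section \<open>Isomorphisms and full subcategories\<close>

lemma Hom_full_subcat: "Hom (full_subcat D S) a b = (if a \<in> S \<and> b \<in> S then Hom D a b else {})"
  by (auto simp: full_subcat_def Hom_def)

lemma full_subcat_sel [simp]:
  "Ob (full_subcat D S) = Ob D \<inter> S" "Idt (full_subcat D S) = Idt D" "Cmp (full_subcat D S) = Cmp D"
  by (simp_all add: full_subcat_def)

lemma full_subcat_full_subcat: "full_subcat (full_subcat D S) T = full_subcat D (S \<inter> T)"
  by (auto simp: full_subcat_def)

lemma isomorphic_full_subcat:
  "isomorphic (full_subcat D S) a b \<longleftrightarrow> a \<in> S \<and> b \<in> S \<and> isomorphic D a b"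
  by (auto simp: isomorphic_def iso_arrow_def Hom_full_subcat)

lemma category_full_subcat:
  assumes "category D"
  shows "category (full_subcat D S)"
proof -
  interpret category D by fact
  show ?thesis
  proof
    show "Dom (full_subcat D S) f \<in> Ob (full_subcat D S)"
      and "Cod (full_subcat D S) f \<in> Ob (full_subcat D S)" if "f \<in> Ar (full_subcat D S)" for f
      using that Dom_in_Ob Cod_in_Ob by (auto simp: full_subcat_def)
  qed (auto simp: Hom_full_subcat Idt_in_Hom Cmp_in_Hom Cmp_Idt Idt_Cmp Cmp_assoc split: if_splits)
qed

context category
begin

lemma Hom_Ob:
  assumes "f \<in> Hom C a b"
  shows "a \<in> Ob C" "b \<in> Ob C"
  using assms Dom_in_Ob Cod_in_Ob by (auto simp: Hom_def)

lemma isomorphic_sym: "isomorphic C a b \<Longrightarrow> isomorphic C b a"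
  unfolding isomorphic_def iso_arrow_def by blast

lemma isomorphic_trans:
  assumes "isomorphic C a b" "isomorphic C b c"
  shows "isomorphic C a c"
proof -
  obtain f f' where f: "f \<in> Hom C a b" "f' \<in> Hom C b a" "f' \<cdot> f = Idt C a" "f \<cdot> f' = Idt C b"
    using assms(1) by (auto simp: isomorphic_def iso_arrow_def)
  obtain g g' where g: "g \<in> Hom C b c" "g' \<in> Hom C c b" "g' \<cdot> g = Idt C b" "g \<cdot> g' = Idt C c"
    using assms(2) by (auto simp: isomorphic_def iso_arrow_def)
  have 1: "(f' \<cdot> g') \<cdot> (g \<cdot> f) = Idt C a"
  proof -
    have "(f' \<cdot> g') \<cdot> (g \<cdot> f) = f' \<cdot> (g' \<cdot> (g \<cdot> f))"
      using Cmp_assoc[of "g \<cdot> f" a c g' b f' a] Cmp_in_Hom f g by metis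
    also have "g' \<cdot> (g \<cdot> f) = f"
      using Cmp_assoc[of f a b g c g' b] Idt_Cmp f g by metis
    finally show ?thesis using f by simp
  qed
  have 2: "(g \<cdot> f) \<cdot> (f' \<cdot> g') = Idt C c"
  proof -
    have "(g \<cdot> f) \<cdot> (f' \<cdot> g') = g \<cdot> (f \<cdot> (f' \<cdot> g'))"
      using Cmp_assoc[of "f' \<cdot> g'" c a f b g c] Cmp_in_Hom f g by metis
    also have "f \<cdot> (f' \<cdot> g') = g'"
      using Cmp_assoc[of g' c b f' a f b] Idt_Cmp f g by metis
    finally show ?thesis using g by simp
  qed
  show ?thesis
    unfolding isomorphic_def iso_arrow_def using 1 2 f g Cmp_in_Hom Hom_Ob by metis
qed

end

lemma functor_isomorphic:
  assumes "is_functor A B F" "category A" "isomorphic A a b"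
  shows "isomorphic B (omap F a) (omap F b)"
proof -
  interpret category A by fact
  obtain f g where fg: "f \<in> Hom A a b" "g \<in> Hom A b a"
      "g \<cdot>\<^bsub>A\<^esub> f = Idt A a" "f \<cdot>\<^bsub>A\<^esub> g = Idt A b"
    using assms(3) by (auto simp: isomorphic_def iso_arrow_def)
  have ob: "omap F a \<in> Ob B" "omap F b \<in> Ob B"
    using assms by (auto simp: isomorphic_def is_functor_def)
  have "amap F f \<in> Hom B (omap F a) (omap F b)" "amap F g \<in> Hom B (omap F b) (omap F a)"
    using assms(1) fg by (auto simp: is_functor_def Hom_def)
  moreover have "amap F g \<cdot>\<^bsub>B\<^esub> amap F f = Idt B (omap F a)"
    using assms(1) fg Hom_Ob[OF fg(1)]
    by (simp add: is_functor_def Hom_def) metis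
  moreover have "amap F f \<cdot>\<^bsub>B\<^esub> amap F g = Idt B (omap F b)"
    using assms(1) fg Hom_Ob[OF fg(1)]
    by (simp add: is_functor_def Hom_def) metis
  ultimately show ?thesis
    unfolding isomorphic_def iso_arrow_def using ob by blast
qed

text \<open>The image under \<open>G\<close> of the given isomorphism lies between \<open>G (F a)\<close> and \<open>G (F b)\<close>, which the unit
  identifies with \<open>a\<close> and \<open>b\<close>.\<close>

lemma equivalence_reflects_isomorphic:
  assumes "equivalence A B F G" "category A" "category B"
    and "a \<in> Ob A" "b \<in> Ob A"
    and "isomorphic B (omap F a) (omap F b)"
  shows "isomorphic A a b"
proof -
  interpret category A by fact
  have F: "is_functor A B F" and G: "is_functor B A G"
    using assms(1) by (auto simp: equivalence_def)
  obtain h where "natural_iso A A id_func (G \<circ>\<^sub>F F) h"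
    using assms(1) by (auto simp: equivalence_def)
  then have unit: "isomorphic A c (omap G (omap F c))" if "c \<in> Ob A" for c
    using that F G
    by (auto simp: natural_iso_def isomorphic_def id_func_def comp_func_def is_functor_def)
  from functor_isomorphic[OF G assms(3,6)] show ?thesis
    using unit[OF assms(4)] unit[OF assms(5)] isomorphic_sym isomorphic_trans by blast
qed


section \<open>Local equivalences and reflections\<close>

text \<open>An \<open>S\<close>-local equivalence in the sense of localization theory: the objects of \<open>S\<close> see \<open>k\<close> as an
  isomorphism. A reflection in the full subcategory on \<open>S\<close> is such an arrow with codomain in \<open>S\<close>, and
  so is, for \<open>S = \<M>\<close>, every map over a space whose underlying arrow is final; this allows both to be
  composed and cancelled by one rule.\<close>

definition local_equivalence ::
    "('o, 'a, 'r) cat_scheme \<Rightarrow> 'o set \<Rightarrow> 'o \<Rightarrow> 'o \<Rightarrow> 'a \<Rightarrow> bool" where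
  "local_equivalence D S a b k \<longleftrightarrow>
    k \<in> Hom D a b \<and> (\<forall>c \<in> Ob D \<inter> S. \<forall>g \<in> Hom D a c. \<exists>!h. h \<in> Hom D b c \<and> h \<cdot>\<^bsub>D\<^esub> k = g)"

lemma local_equivalence_subset:
  "local_equivalence D S a b k \<Longrightarrow> T \<subseteq> S \<Longrightarrow> local_equivalence D T a b k"
  unfolding local_equivalence_def by blast

context category
begin

lemma is_reflection_iff_local_equivalence:
  "is_reflection C (full_subcat C S) a r t \<longleftrightarrow> r \<in> S \<and> local_equivalence C S a r t"
proof -
  have "is_reflection C (full_subcat C S) a r t \<longleftrightarrow>
      a \<in> Ob C \<and> r \<in> Ob C \<and> r \<in> S \<and> local_equivalence C S a r t"
    by (cases "r \<in> S") (auto simp: is_reflection_def local_equivalence_def Hom_full_subcat)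
  then show ?thesis using Hom_Ob unfolding local_equivalence_def by blast
qed

text \<open>Since every arrow from \<open>a\<close> to an object of \<open>S\<close> is \<open>g' \<cdot> k\<close> for exactly one \<open>g'\<close>, factoring it
  through \<open>l \<cdot> k\<close> amounts to factoring \<open>g'\<close> through \<open>l\<close>.\<close>

lemma local_equivalence_comp_iff:
  assumes k: "local_equivalence C S a b k" and l: "l \<in> Hom C b c"
  shows "local_equivalence C S a c (l \<cdot> k) \<longleftrightarrow> local_equivalence C S b c l"
proof -
  have kH: "k \<in> Hom C a b" using k by (simp add: local_equivalence_def)
  have lk: "l \<cdot> k \<in> Hom C a c" using Cmp_in_Hom[OF kH l] .
  have assoc: "h \<cdot> (l \<cdot> k) = (h \<cdot> l) \<cdot> k" if "h \<in> Hom C c d" for h d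
    using Cmp_assoc[OF kH l that] .
  have ex: "\<exists>!g'. g' \<in> Hom C b d \<and> g' \<cdot> k = g" if "d \<in> Ob C \<inter> S" "g \<in> Hom C a d" for d g
    using k that unfolding local_equivalence_def by blast
  have "(\<forall>g \<in> Hom C a d. \<exists>!h. h \<in> Hom C c d \<and> h \<cdot> (l \<cdot> k) = g) \<longleftrightarrow>
        (\<forall>g' \<in> Hom C b d. \<exists>!h. h \<in> Hom C c d \<and> h \<cdot> l = g')" (is "?L \<longleftrightarrow> ?R")
    if d: "d \<in> Ob C \<inter> S" for d
  proof -
    have key: "h \<cdot> (l \<cdot> k) = g' \<cdot> k \<longleftrightarrow> h \<cdot> l = g'"
      if "h \<in> Hom C c d" "g' \<in> Hom C b d" for h g'
      using ex[OF d] assoc[OF that(1)] Cmp_in_Hom[OF l that(1)] Cmp_in_Hom[OF kH that(2)] that(2)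
      by metis
    show ?thesis
    proof
      assume L: ?L
      show ?R
      proof
        fix g' assume g': "g' \<in> Hom C b d"
        from L Cmp_in_Hom[OF kH g'] have "\<exists>!h. h \<in> Hom C c d \<and> h \<cdot> (l \<cdot> k) = g' \<cdot> k" by blast
        then show "\<exists>!h. h \<in> Hom C c d \<and> h \<cdot> l = g'" using key[OF _ g'] by metis
      qed
    next
      assume R: ?R
      show ?L
      proof
        fix g assume "g \<in> Hom C a d"
        then obtain g' where g': "g' \<in> Hom C b d" "g' \<cdot> k = g" using ex[OF d] by blast
        from R g'(1) have "\<exists>!h. h \<in> Hom C c d \<and> h \<cdot> l = g'" by blast
        then show "\<exists>!h. h \<in> Hom C c d \<and> h \<cdot> (l \<cdot> k) = g" using key[OF _ g'(1)] g'(2) by metis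
      qed
    qed
  qed
  from ball_cong[OF refl this] show ?thesis
    unfolding local_equivalence_def using lk l by (simp only: simp_thms)
qed

text \<open>The object \<open>r\<close> is the same on both sides, so that no isomorphism has to be transported when
  colimits are compared along a local equivalence.\<close>

lemma local_equivalence_same_reflections:
  assumes k: "local_equivalence C S a b k"
  shows "(\<exists>t. is_reflection C (full_subcat C S) a r t) \<longleftrightarrow>
         (\<exists>t. is_reflection C (full_subcat C S) b r t)"
proof
  assume "\<exists>t. is_reflection C (full_subcat C S) a r t"
  then obtain t where r: "r \<in> S" and t: "local_equivalence C S a r t"
    by (auto simp: is_reflection_iff_local_equivalence)
  from t have "t \<in> Hom C a r" by (simp add: local_equivalence_def)
  then obtain l where "l \<in> Hom C b r" "l \<cdot> k = t"
    using k r Hom_Ob(2) unfolding local_equivalence_def by blast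
  then show "\<exists>t. is_reflection C (full_subcat C S) b r t"
    using local_equivalence_comp_iff[OF k] r t by (auto simp: is_reflection_iff_local_equivalence)
next
  assume "\<exists>t. is_reflection C (full_subcat C S) b r t"
  then obtain t where r: "r \<in> S" and t: "local_equivalence C S b r t"
    by (auto simp: is_reflection_iff_local_equivalence)
  from t have "t \<in> Hom C b r" by (simp add: local_equivalence_def)
  then show "\<exists>t. is_reflection C (full_subcat C S) a r t"
    using local_equivalence_comp_iff[OF k] r t by (auto simp: is_reflection_iff_local_equivalence)
qed

lemma reflection_unique:
  assumes "is_reflection C (full_subcat C S) a r t"
    and "is_reflection C (full_subcat C S) a s u"
  shows "isomorphic (full_subcat C S) r s"
proof -
  have r: "r \<in> S" and t: "local_equivalence C S a r t" and s: "s \<in> S"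
    and u: "local_equivalence C S a s u"
    using assms by (auto simp: is_reflection_iff_local_equivalence)
  have tH: "t \<in> Hom C a r" and uH: "u \<in> Hom C a s"
    using t u by (auto simp: local_equivalence_def)
  have ob: "r \<in> Ob C" "s \<in> Ob C" using Hom_Ob tH uH by auto
  obtain h where h: "h \<in> Hom C r s" "h \<cdot> t = u"
    using t s uH ob unfolding local_equivalence_def by blast
  obtain k where k: "k \<in> Hom C s r" "k \<cdot> u = t"
    using u r tH ob unfolding local_equivalence_def by blast
  have "(k \<cdot> h) \<cdot> t = t" "(h \<cdot> k) \<cdot> u = u"
    using Cmp_assoc[OF tH h(1) k(1)] Cmp_assoc[OF uH k(1) h(1)] h(2) k(2) by simp_all
  moreover have "Idt C r \<cdot> t = t" "Idt C s \<cdot> u = u"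
    using Idt_Cmp tH uH by auto
  moreover have "k \<cdot> h \<in> Hom C r r" "h \<cdot> k \<in> Hom C s s" "Idt C r \<in> Hom C r r" "Idt C s \<in> Hom C s s"
    using Cmp_in_Hom Idt_in_Hom h k ob by blast+
  ultimately have "k \<cdot> h = Idt C r" "h \<cdot> k = Idt C s"
    using t u r s ob tH uH unfolding local_equivalence_def by blast+
  then show ?thesis
    unfolding isomorphic_full_subcat isomorphic_def[of C] iso_arrow_def[of C]
    using h(1) k(1) ob r s by blast
qed

end


text \<open>Links the two kinds of colimit: a colimit of a discrete space, which is a reflection out of the
  category of discrete spaces, is also a reflection out of the whole slice.\<close>

lemma is_reflection_full_subcat:
  assumes "is_reflection (full_subcat D S) (full_subcat (full_subcat D S) T) a r t"
  shows "is_reflection D (full_subcat (full_subcat D S) T) a r t"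
proof -
  have "a \<in> S"
    using assms by (simp add: is_reflection_def)
  then have eq: "Hom (full_subcat D S) a b = Hom D a b"
    if "b \<in> Ob (full_subcat (full_subcat D S) T)" for b
    using that by (simp add: Hom_full_subcat)
  have r: "r \<in> Ob (full_subcat (full_subcat D S) T)" and "a \<in> Ob D"
    using assms by (simp_all add: is_reflection_def)
  moreover have "t \<in> Hom D a r"
    using assms eq[OF r] by (simp add: is_reflection_def)
  moreover have "\<exists>!h. h \<in> Hom (full_subcat (full_subcat D S) T) r b \<and> h \<cdot>\<^bsub>D\<^esub> t = g"
    if "b \<in> Ob (full_subcat (full_subcat D S) T)" "g \<in> Hom D a b" for b g
    using assms that(1) that(2)[folded eq[OF that(1)]] unfolding is_reflection_def full_subcat_sel(3)
    by blast
  ultimately show ?thesis unfolding is_reflection_def by blast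
qed


section \<open>Spaces over a fixed space\<close>

lemma slice_sel:
  "Ob (slice C X) = {p \<in> Ar C. Cod C p = X}"
  "Idt (slice C X) p = (p, Idt C (Dom C p), p)"
  "Cmp (slice C X) (q', v, r) (p, u, q) = (p, v \<cdot>\<^bsub>C\<^esub> u, r)"
  by (simp_all add: slice_def)

lemma in_Hom_slice:
  "t \<in> Hom (slice C X) p q \<longleftrightarrow>
    p \<in> Ob (slice C X) \<and> q \<in> Ob (slice C X) \<and>
    (\<exists>u. t = (p, u, q) \<and> u \<in> Hom C (Dom C p) (Dom C q) \<and> q \<cdot>\<^bsub>C\<^esub> u = p)"
  by (auto simp: slice_def Hom_def)

context category
begin

lemma category_slice: "category (slice C X)"
proof
  fix t p q s u v
  show "Dom (slice C X) t \<in> Ob (slice C X)" "Cod (slice C X) t \<in> Ob (slice C X)"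
    if "t \<in> Ar (slice C X)"
    using that by (auto simp: slice_def)
  have ob: "n \<in> Hom C (Dom C n) X" if "n \<in> Ob (slice C X)" for n
    using that by (simp add: slice_sel Hom_def)
  show "Idt (slice C X) p \<in> Hom (slice C X) p p" if p: "p \<in> Ob (slice C X)"
    using p Idt_in_Hom[OF Hom_Ob(1)[OF ob[OF p]]] Cmp_Idt[OF ob[OF p]]
    by (simp add: in_Hom_slice slice_sel(2))
  show "t \<cdot>\<^bsub>slice C X\<^esub> Idt (slice C X) p = t" "Idt (slice C X) q \<cdot>\<^bsub>slice C X\<^esub> t = t"
    if "t \<in> Hom (slice C X) p q"
    using that Cmp_Idt Idt_Cmp by (auto simp: in_Hom_slice slice_sel)
  assume t: "t \<in> Hom (slice C X) p q" and u: "u \<in> Hom (slice C X) q s"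
  obtain t' where t': "t = (p, t', q)" "t' \<in> Hom C (Dom C p) (Dom C q)" "q \<cdot> t' = p"
    using t by (auto simp: in_Hom_slice)
  obtain u' where u': "u = (q, u', s)" "u' \<in> Hom C (Dom C q) (Dom C s)" "s \<cdot> u' = q"
    using u by (auto simp: in_Hom_slice)
  have s: "s \<in> Ob (slice C X)" using u by (simp add: in_Hom_slice)
  show "u \<cdot>\<^bsub>slice C X\<^esub> t \<in> Hom (slice C X) p s"
    using t u t' u' Cmp_in_Hom[OF t'(2) u'(2)] Cmp_assoc[OF t'(2) u'(2) ob[OF s]]
    by (simp add: in_Hom_slice slice_sel(3))
  show "v \<cdot>\<^bsub>slice C X\<^esub> (u \<cdot>\<^bsub>slice C X\<^esub> t) = (v \<cdot>\<^bsub>slice C X\<^esub> u) \<cdot>\<^bsub>slice C X\<^esub> t"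
    if v: "v \<in> Hom (slice C X) s r" for r
  proof -
    obtain v' where v': "v = (s, v', r)" "v' \<in> Hom C (Dom C s) (Dom C r)"
      using v by (auto simp: in_Hom_slice)
    show ?thesis using Cmp_assoc[OF t'(2) u'(2) v'(2)] t'(1) u'(1) v'(1) by (simp add: slice_sel(3))
  qed
qed

lemma isomorphic_slice_iso_arrow:
  assumes "isomorphic (slice C X) p q"
  obtains k where "iso_arrow C (Dom C p) (Dom C q) k" "q \<cdot> k = p"
proof -
  obtain s t where "s \<in> Hom (slice C X) p q" "t \<in> Hom (slice C X) q p"
      "t \<cdot>\<^bsub>slice C X\<^esub> s = Idt (slice C X) p" "s \<cdot>\<^bsub>slice C X\<^esub> t = Idt (slice C X) q"
    using assms by (auto simp: isomorphic_def iso_arrow_def)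
  moreover from this(1,2) obtain k l where
      k: "s = (p, k, q)" "k \<in> Hom C (Dom C p) (Dom C q)" "q \<cdot> k = p"
      and l: "t = (q, l, p)" "l \<in> Hom C (Dom C q) (Dom C p)"
    unfolding in_Hom_slice by blast
  ultimately have "l \<cdot> k = Idt C (Dom C p)" "k \<cdot> l = Idt C (Dom C q)"
    by (simp_all add: slice_sel)
  then show thesis using that k l unfolding iso_arrow_def by blast
qed

lemma iso_arrow_orthogonal:
  assumes "iso_arrow C a b k" "m \<in> Ar C"
  shows "orthogonal C k m"
proof -
  obtain j where k: "k \<in> Hom C a b" and j: "j \<in> Hom C b a"
    and jk: "j \<cdot> k = Idt C a" and kj: "k \<cdot> j = Idt C b"
    using assms by (auto simp: iso_arrow_def)
  have kd: "Dom C k = a" "Cod C k = b" using k by (auto simp: Hom_def)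
  have m: "m \<in> Hom C (Dom C m) (Cod C m)" using assms by (simp add: Hom_def)
  show ?thesis
    unfolding orthogonal_def kd
  proof (intro ballI impI)
    fix f g assume f: "f \<in> Hom C a (Dom C m)" and g: "g \<in> Hom C b (Cod C m)"
      and sq: "g \<cdot> k = m \<cdot> f"
    show "\<exists>!u. u \<in> Hom C b (Dom C m) \<and> u \<cdot> k = f \<and> m \<cdot> u = g"
    proof
      show "f \<cdot> j \<in> Hom C b (Dom C m) \<and> (f \<cdot> j) \<cdot> k = f \<and> m \<cdot> (f \<cdot> j) = g"
        using Cmp_in_Hom[OF j f] Cmp_assoc[OF k j f] jk Cmp_Idt[OF f] Cmp_assoc[OF j f m]
          Cmp_assoc[OF j k g] sq kj Cmp_Idt[OF g] by simp
    next
      fix u assume u: "u \<in> Hom C b (Dom C m) \<and> u \<cdot> k = f \<and> m \<cdot> u = g"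
      then show "u = f \<cdot> j"
        using Cmp_assoc[OF j k, of u "Dom C m"] kj Cmp_Idt[of u b "Dom C m"] by simp
    qed
  qed
qed

text \<open>The diagonal is found in two stages, first against \<open>e\<close> and then against \<open>k\<close>; uniqueness against
  \<open>e\<close> shows that every diagonal for \<open>k \<cdot> e\<close> restricts along \<open>k\<close> to the first one.\<close>

lemma orthogonal_comp_iso_arrow:
  assumes e: "e \<in> Hom C a b" and k: "iso_arrow C b c k" and m: "m \<in> Ar C"
    and em: "orthogonal C e m"
  shows "orthogonal C (k \<cdot> e) m"
proof -
  have kH: "k \<in> Hom C b c" using k by (simp add: iso_arrow_def)
  have ke: "k \<cdot> e \<in> Hom C a c" using Cmp_in_Hom[OF e kH] .
  have d: "Dom C e = a" "Cod C e = b" "Dom C (k \<cdot> e) = a" "Cod C (k \<cdot> e) = c"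
    "Dom C k = b" "Cod C k = c"
    using e ke kH by (auto simp: Hom_def)
  have mH: "m \<in> Hom C (Dom C m) (Cod C m)" using m by (simp add: Hom_def)
  show ?thesis
    unfolding orthogonal_def d
  proof (intro ballI impI)
    fix f g assume f: "f \<in> Hom C a (Dom C m)" and g: "g \<in> Hom C c (Cod C m)"
      and sq: "g \<cdot> k \<cdot> e = m \<cdot> f"
    have gk: "g \<cdot> k \<in> Hom C b (Cod C m)" using Cmp_in_Hom[OF kH g] .
    have "(g \<cdot> k) \<cdot> e = m \<cdot> f" using sq Cmp_assoc[OF e kH g] by simp
    then have E1: "\<exists>!v. v \<in> Hom C b (Dom C m) \<and> v \<cdot> e = f \<and> m \<cdot> v = g \<cdot> k"
      using em f gk unfolding orthogonal_def d by blast
    then obtain v where v: "v \<in> Hom C b (Dom C m)" "v \<cdot> e = f" "m \<cdot> v = g \<cdot> k" by blast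
    have "\<exists>!u. u \<in> Hom C c (Dom C m) \<and> u \<cdot> k = v \<and> m \<cdot> u = g"
      using iso_arrow_orthogonal[OF k m] v g unfolding orthogonal_def d by simp
    moreover have "u \<cdot> k \<cdot> e = f \<and> m \<cdot> u = g \<longleftrightarrow> u \<cdot> k = v \<and> m \<cdot> u = g"
      if u: "u \<in> Hom C c (Dom C m)" for u
      using E1 v Cmp_assoc[OF e kH u] Cmp_assoc[OF kH u mH] Cmp_in_Hom[OF kH u] by metis
    ultimately show "\<exists>!u. u \<in> Hom C c (Dom C m) \<and> u \<cdot> k \<cdot> e = f \<and> m \<cdot> u = g"
      by metis
  qed
qed

lemma comp_in_Ob_slice:
  assumes "p \<in> Ob (slice C X)" "f \<in> Hom C X Y"
  shows "f \<cdot> p \<in> Ob (slice C Y)" "Dom C (f \<cdot> p) = Dom C p"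
  using Cmp_in_Hom[of p "Dom C p" X f Y] assms by (auto simp: slice_sel Hom_def)

end


section \<open>Final maps and colimits\<close>

lemma adherence_eq:
  "adherence C Y = full_subcat (slice C Y) (\<M>\<^bsub>C\<^esub> \<inter> nbhd C ` points C Y)"
  by (simp add: adherence_def discrete_def full_subcat_full_subcat)

context category_of_spaces
begin

lemma fin_Ar: "e \<in> \<E> \<Longrightarrow> e \<in> Ar C"
  and finI: "e \<in> Ar C \<Longrightarrow> (\<And>m. m \<in> \<M> \<Longrightarrow> orthogonal C e m) \<Longrightarrow> e \<in> \<E>"
  and dsc_Ar: "m \<in> \<M> \<Longrightarrow> m \<in> Ar C"
  and dscI: "m \<in> Ar C \<Longrightarrow> (\<And>e. e \<in> \<E> \<Longrightarrow> orthogonal C e m) \<Longrightarrow> m \<in> \<M>"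
  and fin_dsc_orthogonal: "e \<in> \<E> \<Longrightarrow> m \<in> \<M> \<Longrightarrow> orthogonal C e m"
proof -
  have "\<E> = {e \<in> Ar C. \<forall>m \<in> \<M>. orthogonal C e m}" "\<M> = {m \<in> Ar C. \<forall>e \<in> \<E>. orthogonal C e m}"
    using factorization_system unfolding factorization_system_def by blast+
  then show "e \<in> \<E> \<Longrightarrow> e \<in> Ar C"
    "e \<in> Ar C \<Longrightarrow> (\<And>m. m \<in> \<M> \<Longrightarrow> orthogonal C e m) \<Longrightarrow> e \<in> \<E>"
    "m \<in> \<M> \<Longrightarrow> m \<in> Ar C"
    "m \<in> Ar C \<Longrightarrow> (\<And>e. e \<in> \<E> \<Longrightarrow> orthogonal C e m) \<Longrightarrow> m \<in> \<M>"
    "e \<in> \<E> \<Longrightarrow> m \<in> \<M> \<Longrightarrow> orthogonal C e m"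
    by blast+
qed

lemma iso_arrow_fin:
  assumes "iso_arrow C a b k"
  shows "k \<in> \<E>"
proof (rule finI)
  show "k \<in> Ar C" using assms by (simp add: iso_arrow_def Hom_def)
qed (rule iso_arrow_orthogonal[OF assms dsc_Ar])

lemma down_rmap:
  assumes "p \<in> Ob (slice C X)"
  shows "\<down> p \<in> Ob (slice C X)" "\<down> p \<in> \<M>" "rmap C p \<in> \<E>"
    "rmap C p \<in> Hom C (Dom C p) (Dom C (\<down> p))" "\<down> p \<cdot> rmap C p = p"
proof -
  let ?e = "rmap C p" and ?m = "\<down> p"
  have f: "?e \<in> \<E>" "?m \<in> \<M>" "Cod C ?e = Dom C ?m" "p = ?m \<cdot> ?e"
    using assms chosen_factorization[of p] by (auto simp: slice_sel is_factorization_def)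
  have "?e \<in> Hom C (Dom C ?e) (Dom C ?m)" "?m \<in> Hom C (Dom C ?m) (Cod C ?m)"
    using f(3) fin_Ar[OF f(1)] dsc_Ar[OF f(2)] by (auto simp: Hom_def)
  from Cmp_in_Hom[OF this] f(4) have "Dom C ?e = Dom C p" "Cod C ?m = Cod C p"
    by (auto simp: Hom_def)
  then show "\<down> p \<in> Ob (slice C X)" "\<down> p \<in> \<M>" "rmap C p \<in> \<E>"
    "rmap C p \<in> Hom C (Dom C p) (Dom C (\<down> p))" "\<down> p \<cdot> rmap C p = p"
    using f(1-3) f(4)[symmetric] fin_Ar[OF f(1)] dsc_Ar[OF f(2)] assms by (auto simp: Hom_def slice_sel)
qed

text \<open>A map from \<open>p\<close> to a discrete space \<open>n\<close> over \<open>X\<close> is a commutative square from \<open>k\<close> to \<open>n\<close> with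
  lower side \<open>q\<close>, and its extensions along \<open>k\<close> are the diagonals of that square.\<close>

lemma fin_local_equivalence:
  assumes "p \<in> Ob (slice C X)" "q \<in> Ob (slice C X)"
    and k: "k \<in> \<E>" "k \<in> Hom C (Dom C p) (Dom C q)" "q \<cdot> k = p"
  shows "local_equivalence (slice C X) \<M> p q (p, k, q)"
  unfolding local_equivalence_def
proof (intro conjI ballI)
  show "(p, k, q) \<in> Hom (slice C X) p q"
    using assms by (auto simp: in_Hom_slice)
next
  fix n t assume n: "n \<in> Ob (slice C X) \<inter> \<M>" and t: "t \<in> Hom (slice C X) p n"
  from t obtain u where u: "t = (p, u, n)" "u \<in> Hom C (Dom C p) (Dom C n)" "n \<cdot> u = p"
    by (auto simp: in_Hom_slice)
  have "orthogonal C k n" using fin_dsc_orthogonal k(1) n by blast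
  moreover have "q \<in> Hom C (Cod C k) (Cod C n)" "Dom C k = Dom C p" "Cod C k = Dom C q"
    using assms n by (auto simp: Hom_def slice_sel)
  ultimately have "\<exists>!w. w \<in> Hom C (Dom C q) (Dom C n) \<and> w \<cdot> k = u \<and> n \<cdot> w = q"
    using u k(3) by (auto simp: orthogonal_def)
  moreover have lift: "h \<in> Hom (slice C X) q n \<and> h \<cdot>\<^bsub>slice C X\<^esub> (p, k, q) = t \<longleftrightarrow>
      (\<exists>w. h = (q, w, n) \<and> w \<in> Hom C (Dom C q) (Dom C n) \<and> w \<cdot> k = u \<and> n \<cdot> w = q)" for h
    using assms(2) n u(1) by (auto simp: in_Hom_slice slice_sel(3))
  ultimately show "\<exists>!h. h \<in> Hom (slice C X) q n \<and> h \<cdot>\<^bsub>slice C X\<^esub> (p, k, q) = t"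
    unfolding lift by blast
qed

lemma down_is_reflection:
  assumes "p \<in> Ob (slice C X)"
  shows "is_reflection (slice C X) (discrete C X) p (\<down> p) (p, rmap C p, \<down> p)"
  unfolding discrete_def category.is_reflection_iff_local_equivalence[OF category_slice]
  using fin_local_equivalence[OF assms down_rmap(1)[OF assms]] down_rmap[OF assms] by blast

text \<open>Composition with \<open>f\<close> changes the base space but not the underlying arrow \<open>k\<close>, so finality of \<open>k\<close>
  is usable over \<open>Y\<close>, where colimits are reflections in a full subcategory of discrete spaces.\<close>

lemma fin_same_Colim:
  assumes "p \<in> Ob (slice C X)" "q \<in> Ob (slice C X)"
    and k: "k \<in> \<E>" "k \<in> Hom C (Dom C p) (Dom C q)" "q \<cdot> k = p"
    and f: "f \<in> Hom C X Y"
  shows "is_Colim C Y (f \<cdot> p) z \<longleftrightarrow> is_Colim C Y (f \<cdot> q) z"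
proof -
  have "q \<in> Hom C (Dom C q) X" using assms by (simp add: slice_sel Hom_def)
  then have "(f \<cdot> q) \<cdot> k = f \<cdot> p" using Cmp_assoc[OF k(2), of q X f Y] f k(3) by simp
  then have "local_equivalence (slice C Y) \<M> (f \<cdot> p) (f \<cdot> q) (f \<cdot> p, k, f \<cdot> q)"
    using fin_local_equivalence comp_in_Ob_slice[OF assms(1) f] comp_in_Ob_slice[OF assms(2) f] k
    by simp
  then have "local_equivalence (slice C Y) (\<M> \<inter> nbhd C ` points C Y)
      (f \<cdot> p) (f \<cdot> q) (f \<cdot> p, k, f \<cdot> q)"
    by (rule local_equivalence_subset) simp
  then show ?thesis
    unfolding is_Colim_def adherence_eq
    by (rule category.local_equivalence_same_reflections[OF category_slice])
qed

lemma down_same_Colim: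
  assumes "p \<in> Ob (slice C X)" "f \<in> Hom C X Y"
  shows "is_Colim C Y (f \<cdot> p) z \<longleftrightarrow> is_Colim C Y (f \<cdot> \<down> p) z"
  using fin_same_Colim[OF assms(1) down_rmap(1)[OF assms(1)]] down_rmap[OF assms(1)] assms(2)
  by blast

lemma Colim_unique:
  "is_Colim C Y p z \<Longrightarrow> is_Colim C Y p w \<Longrightarrow> isomorphic (adherence C Y) z w"
  unfolding is_Colim_def adherence_eq
  using category.reflection_unique[OF category_slice] by blast

lemma isomorphic_down_Colim_iso:
  assumes p: "p \<in> Ob (slice C X)" and q: "q \<in> Ob (slice C X)"
    and iso: "isomorphic (discrete C X) (\<down> p) (\<down> q)" and f: "f \<in> Hom C X Y"
  shows "Colim_iso C Y (f \<cdot> p) (f \<cdot> q)"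
proof -
  obtain k where k: "iso_arrow C (Dom C (\<down> p)) (Dom C (\<down> q)) k" "\<down> q \<cdot> k = \<down> p"
    using iso isomorphic_slice_iso_arrow unfolding discrete_def isomorphic_full_subcat by blast
  have kH: "k \<in> Hom C (Dom C (\<down> p)) (Dom C (\<down> q))" using k by (simp add: iso_arrow_def)
  have "is_Colim C Y (f \<cdot> p) z \<longleftrightarrow> is_Colim C Y (f \<cdot> q) z" for z
    using fin_same_Colim[OF down_rmap(1)[OF p] down_rmap(1)[OF q] iso_arrow_fin[OF k(1)] kH k(2) f]
      down_same_Colim[OF p f] down_same_Colim[OF q f] by blast
  then show ?thesis
    unfolding Colim_iso_def using Colim_unique by blast
qed

text \<open>The partial left adjoints compose: reflecting \<open>p\<close> first to a discrete space and then to a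
  neighborhood of a point is reflecting it to the neighborhood of a point.\<close>

lemma has_colim_is_Colim:
  assumes p: "p \<in> Ob (slice C Y)" and "has_colim C Y (\<down> p)"
  shows "is_Colim C Y p (fst (chosen_colim C Y (\<down> p)))"
proof -
  let ?m = "\<down> p" and ?z = "fst (chosen_colim C Y (\<down> p))" and ?c = "snd (chosen_colim C Y (\<down> p))"
  have "is_reflection (discrete C Y) (adherence C Y) ?m ?z ?c"
    using assms(2) someI_ex[of "\<lambda>zc. is_reflection (discrete C Y) (adherence C Y) ?m (fst zc) (snd zc)"]
    by (auto simp: has_colim_def chosen_colim_def)
  then have "is_reflection (slice C Y) (adherence C Y) ?m ?z ?c"
    unfolding discrete_def adherence_def by (rule is_reflection_full_subcat)
  then have m: "is_Colim C Y ?m ?z" unfolding is_Colim_def by blast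
  have Y: "Y \<in> Ob C" using p Cod_in_Ob by (auto simp: slice_sel)
  \<comment> \<open>Finality of the reflection map is applied over \<open>Y\<close> itself, that is, along the identity of \<open>Y\<close>.\<close>
  have "Idt C Y \<cdot> q = q" if "q \<in> Ob (slice C Y)" for q
    using that Idt_Cmp[of q "Dom C q" Y] by (simp add: slice_sel Hom_def)
  then show ?thesis
    using m down_same_Colim[OF p Idt_in_Hom[OF Y]] p down_rmap(1)[OF p] by simp
qed

lemma category_discrete: "category (discrete C X)"
  unfolding discrete_def by (rule category_full_subcat[OF category_slice])

lemma category_adherence: "category (adherence C X)"
  unfolding adherence_def by (rule category_full_subcat[OF category_discrete])

text \<open>\<open>\<exists>\<^sub>y\<close> sends \<open>\<down> p\<close> to \<open>\<down> (y \<cdot> \<down> p)\<close>, whose colimit is also the colimit of \<open>y \<cdot> \<down> p\<close> and of \<open>y \<cdot> p\<close>,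
  because the reflection maps are final.\<close>

lemma yoneda_Colim:
  assumes y: "yoneda_map C X PX y" and p: "p \<in> Ob (slice C X)"
  shows "is_Colim C PX (y \<cdot> p) (omap (colim_func C PX \<circ>\<^sub>F Exists_func C y) (\<down> p))"
proof -
  have yH: "y \<in> Hom C X PX" using y by (simp add: yoneda_map_def)
  have m: "\<down> p \<in> Ob (slice C X)" using down_rmap(1)[OF p] .
  have Ex: "omap (Exists_func C y) n = \<down> (y \<cdot> n)" for n
    by (simp add: Exists_func_def down_func_def postcomp_func_def comp_func_def reflector_def)
  have "\<down> p \<in> Ob (discrete C X)" using m down_rmap(2)[OF p] by (simp add: discrete_def)
  then have "has_colim C PX (\<down> (y \<cdot> \<down> p))"
    using y unfolding yoneda_map_def Ex[symmetric] by blast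
  from has_colim_is_Colim[OF comp_in_Ob_slice(1)[OF m yH] this]
  have "is_Colim C PX (y \<cdot> \<down> p) (omap (colim_func C PX \<circ>\<^sub>F Exists_func C y) (\<down> p))"
    by (simp add: comp_func_def Ex colim_func_def reflector_def)
  then show ?thesis using down_same_Colim[OF p yH] by simp
qed

text \<open>Both colimits exist by \<open>yoneda_Colim\<close>, so \<open>Colim_iso\<close> provides an actual isomorphism between the
  images of \<open>\<down> p\<close> and \<open>\<down> q\<close> under an equivalence.\<close>

lemma yoneda_Colim_iso_isomorphic_down:
  assumes y: "yoneda_map C X PX y"
    and p: "p \<in> Ob (slice C X)" and q: "q \<in> Ob (slice C X)"
    and iso: "Colim_iso C PX (y \<cdot> p) (y \<cdot> q)"
  shows "isomorphic (discrete C X) (\<down> p) (\<down> q)"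
proof (rule equivalence_reflects_isomorphic)
  show "equivalence (discrete C X) (adherence C PX)
      (colim_func C PX \<circ>\<^sub>F Exists_func C y) (Delta_func C y \<circ>\<^sub>F id_func)"
    using y by (simp add: yoneda_map_def)
  show "isomorphic (adherence C PX) (omap (colim_func C PX \<circ>\<^sub>F Exists_func C y) (\<down> p))
      (omap (colim_func C PX \<circ>\<^sub>F Exists_func C y) (\<down> q))"
    using iso yoneda_Colim[OF y p] yoneda_Colim[OF y q] unfolding Colim_iso_def by blast
  show "\<down> p \<in> Ob (discrete C X)" "\<down> q \<in> Ob (discrete C X)"
    using down_rmap p q by (auto simp: discrete_def)
qed (rule category_discrete category_adherence)+

lemma isomorphic_down_iff_Colim_iso:
  assumes "has_power_object C X" "p \<in> Ob (slice C X)" "q \<in> Ob (slice C X)"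
  shows "isomorphic (discrete C X) (\<down> p) (\<down> q) \<longleftrightarrow>
    (\<forall>Y \<in> Ob C. \<forall>f \<in> Hom C X Y. Colim_iso C Y (f \<cdot> p) (f \<cdot> q))"
proof -
  obtain PX y where "PX \<in> Ob C" "yoneda_map C X PX y"
    using assms by (auto simp: has_power_object_def)
  then show ?thesis
    using isomorphic_down_Colim_iso[OF assms(2,3)]
      yoneda_Colim_iso_isomorphic_down[OF _ assms(2,3)]
    by (auto simp: yoneda_map_def)
qed

lemma Idt_dsc:
  assumes "X \<in> Ob C"
  shows "Idt C X \<in> \<M>"
proof -
  have I: "Idt C X \<in> Ar C" "Dom C (Idt C X) = X" "Cod C (Idt C X) = X"
    using Idt_in_Hom[OF assms] by (auto simp: Hom_def)
  have "orthogonal C e (Idt C X)" if "e \<in> \<E>" for e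
    unfolding orthogonal_def I(2,3)
  proof (intro ballI impI)
    fix f g assume f: "f \<in> Hom C (Dom C e) X" and g: "g \<in> Hom C (Cod C e) X"
      and "g \<cdot> e = Idt C X \<cdot> f"
    then have "g \<cdot> e = f" using Idt_Cmp by simp
    then show "\<exists>!u. u \<in> Hom C (Cod C e) X \<and> u \<cdot> e = f \<and> Idt C X \<cdot> u = g"
      using g Idt_Cmp[of _ "Cod C e" X] by metis
  qed
  then show ?thesis using I dscI by blast
qed

text \<open>The identity of \<open>X\<close> is discrete and therefore is its own discrete reflection, up to isomorphism. If
  \<open>e\<close> is final, then \<open>e\<close>, viewed as a map from \<open>e\<close> to the identity over \<open>X\<close>, is a discrete reflection
  too. If conversely \<open>\<down> e\<close> is isomorphic to the identity over \<open>X\<close>, then the arrow \<open>\<down> e\<close> is itself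
  invertible, and \<open>e\<close> is a final map followed by an isomorphism.\<close>

lemma fin_iff_isomorphic_down_Idt:
  assumes e: "e \<in> Ob (slice C X)"
  shows "e \<in> \<E> \<longleftrightarrow> isomorphic (discrete C X) (\<down> e) (\<down> (Idt C X))"
proof -
  have X: "X \<in> Ob C" using e Cod_in_Ob by (auto simp: slice_sel)
  note I = Idt_in_Hom[OF X]
  have IdX: "Idt C X \<in> Ob (slice C X)" "Dom C (Idt C X) = X"
    using I by (auto simp: slice_sel Hom_def)
  have eH: "e \<in> Hom C (Dom C e) X" using e by (simp add: slice_sel Hom_def)
  interpret D: category "discrete C X" by (rule category_discrete)
  have final_iso: "isomorphic (discrete C X) (\<down> d) (Idt C X)"
    if d: "d \<in> Ob (slice C X)" "d \<in> \<E>" for d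
  proof -
    have dH: "d \<in> Hom C (Dom C d) X" using d by (simp add: slice_sel Hom_def)
    have "local_equivalence (slice C X) \<M> d (Idt C X) (d, d, Idt C X)"
      using fin_local_equivalence[OF d(1) IdX(1) d(2)] dH Idt_Cmp[OF dH] IdX by simp
    then have "is_reflection (slice C X) (discrete C X) d (Idt C X) (d, d, Idt C X)"
      unfolding discrete_def category.is_reflection_iff_local_equivalence[OF category_slice]
      using Idt_dsc[OF X] by blast
    with down_is_reflection[OF d(1)] show ?thesis
      unfolding discrete_def by (rule category.reflection_unique[OF category_slice])
  qed
  have "iso_arrow C X X (Idt C X)"
    using I Idt_Cmp[OF I] by (auto simp: iso_arrow_def)
  then have "Idt C X \<in> \<E>"
    by (rule iso_arrow_fin)
  then have Idt_iso: "isomorphic (discrete C X) (\<down> (Idt C X)) (Idt C X)"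
    using final_iso IdX by blast
  show ?thesis
  proof
    assume "e \<in> \<E>"
    then show "isomorphic (discrete C X) (\<down> e) (\<down> (Idt C X))"
      using final_iso[OF e] Idt_iso D.isomorphic_sym D.isomorphic_trans by blast
  next
    assume "isomorphic (discrete C X) (\<down> e) (\<down> (Idt C X))"
    from D.isomorphic_trans[OF this Idt_iso] have "isomorphic (slice C X) (\<down> e) (Idt C X)"
      by (simp add: discrete_def isomorphic_full_subcat)
    then obtain k where k: "iso_arrow C (Dom C (\<down> e)) X k" "Idt C X \<cdot> k = \<down> e"
      using isomorphic_slice_iso_arrow IdX(2) by metis
    \<comment> \<open>The only map over \<open>X\<close> from \<open>\<down> e\<close> to the identity has \<open>\<down> e\<close> as its underlying arrow.\<close>
    have "k = \<down> e" using k Idt_Cmp unfolding iso_arrow_def by metis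
    then have "orthogonal C (\<down> e \<cdot> rmap C e) m" if "m \<in> \<M>" for m
      using orthogonal_comp_iso_arrow[OF down_rmap(4)[OF e]] _ dsc_Ar[OF that]
        fin_dsc_orthogonal[OF down_rmap(3)[OF e] that] k(1) by simp
    then show "e \<in> \<E>" using finI[of e] eH down_rmap(5)[OF e] by (simp add: Hom_def)
  qed
qed

text \<open>The discrete reflection of a point is its neighborhood, which already lies in the adherence
  category.\<close>

lemma is_Colim_point:
  assumes "x \<in> points C Y"
  shows "is_Colim C Y x (nbhd C x)"
proof -
  have x: "x \<in> Ob (slice C Y)" using assms by (auto simp: points_def Hom_def slice_sel)
  have "local_equivalence (slice C Y) \<M> x (\<down> x) (x, rmap C x, \<down> x)"
    using fin_local_equivalence[OF x down_rmap(1)[OF x]] down_rmap[OF x] by blast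
  then have "local_equivalence (slice C Y) (\<M> \<inter> nbhd C ` points C Y) x (\<down> x) (x, rmap C x, \<down> x)"
    by (rule local_equivalence_subset) simp
  then show ?thesis
    unfolding is_Colim_def adherence_eq
      category.is_reflection_iff_local_equivalence[OF category_slice]
    using down_rmap(2)[OF x] assms unfolding nbhd_def by blast
qed

text \<open>As \<open>Colim x\<close> exists, the condition that either side exists if the other does becomes the existence
  of \<open>Colim p\<close>.\<close>

lemma Colim_iso_point_iff:
  assumes "x \<in> points C Y"
  shows "Colim_iso_point C Y p x \<longleftrightarrow> Colim_iso C Y p x"
proof -
  interpret A: category "adherence C Y" by (rule category_adherence)
  show ?thesis
    unfolding Colim_iso_point_def Colim_iso_def
    using is_Colim_point[OF assms] Colim_unique A.isomorphic_trans by blast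
qed

end


section \<open>Discrete reflections detected by colimits\<close>

theorem corollary5p2:
  fixes C :: "('o, 'a) spaces" and X :: 'o
  assumes "category_of_spaces C"
    and "X \<in> Ob C"
    and "has_power_object C X"
  shows
    "(\<forall>p \<in> Ob (slice C X). \<forall>q \<in> Ob (slice C X).
        isomorphic (discrete C X) (\<down>\<^bsub>C\<^esub> p) (\<down>\<^bsub>C\<^esub> q) \<longleftrightarrow>
        (\<forall>Y \<in> Ob C. \<forall>f \<in> Hom C X Y. Colim_iso C Y (f \<cdot>\<^bsub>C\<^esub> p) (f \<cdot>\<^bsub>C\<^esub> q))) \<and>
     (\<forall>e \<in> Ob (slice C X).
        e \<in> \<E>\<^bsub>C\<^esub> \<longleftrightarrow>
        (\<forall>Y \<in> Ob C. \<forall>f \<in> Hom C X Y. Colim_iso C Y (f \<cdot>\<^bsub>C\<^esub> e) f)) \<and>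
     (\<forall>p \<in> Ob (slice C X). \<forall>x \<in> points C X.
        absolute_colimit C X p x \<longleftrightarrow>
        (\<forall>Y \<in> Ob C. \<forall>f \<in> Hom C X Y. Colim_iso_point C Y (f \<cdot>\<^bsub>C\<^esub> p) (f \<cdot>\<^bsub>C\<^esub> x)))"
proof (intro conjI ballI)
  interpret category_of_spaces C by fact
  fix p assume p: "p \<in> Ob (slice C X)"
  show "isomorphic (discrete C X) (\<down>\<^bsub>C\<^esub> p) (\<down>\<^bsub>C\<^esub> q) \<longleftrightarrow>
      (\<forall>Y \<in> Ob C. \<forall>f \<in> Hom C X Y. Colim_iso C Y (f \<cdot>\<^bsub>C\<^esub> p) (f \<cdot>\<^bsub>C\<^esub> q))"
    if "q \<in> Ob (slice C X)" for q
    using isomorphic_down_iff_Colim_iso[OF assms(3) p that] .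
  have "Idt C X \<in> Ob (slice C X)"
    using Idt_in_Hom[OF assms(2)] by (simp add: slice_sel Hom_def)
  from isomorphic_down_iff_Colim_iso[OF assms(3) p this]
  show "p \<in> \<E>\<^bsub>C\<^esub> \<longleftrightarrow> (\<forall>Y \<in> Ob C. \<forall>f \<in> Hom C X Y. Colim_iso C Y (f \<cdot>\<^bsub>C\<^esub> p) f)"
    using fin_iff_isomorphic_down_Idt[OF p] by (simp add: Cmp_Idt cong: ball_cong)
  show "absolute_colimit C X p x \<longleftrightarrow>
      (\<forall>Y \<in> Ob C. \<forall>f \<in> Hom C X Y. Colim_iso_point C Y (f \<cdot>\<^bsub>C\<^esub> p) (f \<cdot>\<^bsub>C\<^esub> x))"
    if x: "x \<in> points C X" for x
  proof -
    have xo: "x \<in> Ob (slice C X)" using x by (auto simp: points_def Hom_def slice_sel)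
    have "f \<cdot>\<^bsub>C\<^esub> x \<in> points C Y" if "f \<in> Hom C X Y" for f Y
      using Cmp_in_Hom x that by (auto simp: points_def)
    then show ?thesis
      using isomorphic_down_iff_Colim_iso[OF assms(3) p xo] x Colim_iso_point_iff
      by (simp add: absolute_colimit_def nbhd_def)
  qed
qed

end
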